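(* Assume $\mathfrak{d}>\mathfrak{b}=\aleph_1$. Let $X$ be a compact, completely regular $T_1$ (equivalently, compact Hausdorff) space with an $M$-diagonal for some separable metric space $M$. Then $X$ is metrizable.
   Context: For a topological space $M$, $\mathcal{K}(M)$ is the collection of all compact subsets of $M$, directed by inclusion. A space $Y$ is $M$-dominated if it has a $\mathcal{K}(M)$-directed compact cover, i.e. there are compact sets $K_F\subseteq Y$ ($F\in\mathcal{K}(M)$) with $\bigcup_{F\in\mathcal{K}(M)} K_F=Y$ and $K_F\subseteq K_{F'}$ whenever $F\subseteq F'$. A space $X$ has an $M$-diagonal if $X^2\setminus\Delta$ is $M$-dominated, where $\Delta=\{(x,x):x\in X\}$. For $f,g\in\omega^\omega$, $f\le^* g$ means $\{n:f(n)>g(n)\}$ is finite; $\mathfrak{b}$ is the least cardinality of a subset of $\omega^\omega$ unbounded with respect to $\le^*$, and $\mathfrak{d}$ is the least cardinality of a cofinal subset of $(\omega^\omega,\le^* )$. *)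

theory Defs
  imports "HOL-Analysis.Analysis"
begin

unbundle cardinal_syntax

definition eventually_dominated :: "(nat \<Rightarrow> nat) \<Rightarrow> (nat \<Rightarrow> nat) \<Rightarrow> bool"  (infix \<open>\<le>\<^sup>*\<close> 50)
  where "f \<le>\<^sup>* g \<longleftrightarrow> finite {n. f n > g n}"

text \<open>Cardinals are represented, as in the library, by well-order relations up to \<open>=o\<close>;
  this one is meaningful when some set satisfies \<open>P\<close>.\<close>

definition least_cardinality :: "('a set \<Rightarrow> bool) \<Rightarrow> 'a rel"
  where "least_cardinality P = (SOME \<kappa>. (\<exists>A. P A \<and> \<kappa> = |A| ) \<and> (\<forall>A. P A \<longrightarrow> \<kappa> \<le>o |A| ))"

lemma least_cardinality:
  assumes "P B"
  shows "\<exists>A. P A \<and> least_cardinality P = |A|"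
    and "P A \<Longrightarrow> least_cardinality P \<le>o |A|"
proof -
  let ?R = "card_of ` Collect P"
  have "\<exists>r\<in>?R. \<forall>r'\<in>?R. r \<le>o r'"
    using assms by (intro exists_minim_Card_order) (auto simp: card_of_Card_order)
  then have "\<exists>\<kappa>. (\<exists>A. P A \<and> \<kappa> = |A| ) \<and> (\<forall>A. P A \<longrightarrow> \<kappa> \<le>o |A| )"
    by auto
  then have *: "(\<exists>A. P A \<and> least_cardinality P = |A| ) \<and> (\<forall>A. P A \<longrightarrow> least_cardinality P \<le>o |A| )"
    unfolding least_cardinality_def by (rule someI_ex)
  then show "\<exists>A. P A \<and> least_cardinality P = |A|"
    and "P A \<Longrightarrow> least_cardinality P \<le>o |A|"
    by blast+
qed

definition unbounded_family :: "(nat \<Rightarrow> nat) set \<Rightarrow> bool"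
  where "unbounded_family B \<longleftrightarrow> \<not> (\<exists>g. \<forall>f\<in>B. f \<le>\<^sup>* g)"

definition cofinal_family :: "(nat \<Rightarrow> nat) set \<Rightarrow> bool"
  where "cofinal_family D \<longleftrightarrow> (\<forall>f. \<exists>g\<in>D. f \<le>\<^sup>* g)"

definition bounding_number :: "(nat \<Rightarrow> nat) rel"  (\<open>\<bb>\<close>)
  where "\<bb> = least_cardinality unbounded_family"

definition dominating_number :: "(nat \<Rightarrow> nat) rel"  (\<open>\<dd>\<close>)
  where "\<dd> = least_cardinality cofinal_family"

lemma cofinal_family_UNIV: "cofinal_family UNIV"
proof -
  have "f \<le>\<^sup>* f" for f
    by (simp add: eventually_dominated_def)
  then show ?thesis
    by (auto simp: cofinal_family_def)
qed

lemma unbounded_family_UNIV: "unbounded_family UNIV"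
  unfolding unbounded_family_def
proof
  assume "\<exists>g. \<forall>f\<in>UNIV. f \<le>\<^sup>* g"
  then obtain g where "(\<lambda>n. Suc (g n)) \<le>\<^sup>* g"
    by blast
  then show False
    by (simp add: eventually_dominated_def)
qed

abbreviation aleph_1 :: "nat set rel"  (\<open>\<aleph>\<^sub>1\<close>)
  where "\<aleph>\<^sub>1 \<equiv> cardSuc natLeq"

definition dominated_by :: "'m topology \<Rightarrow> 'a topology \<Rightarrow> bool"
  where "dominated_by M Y \<longleftrightarrow>
    (\<exists>K. (\<forall>F. compactin M F \<longrightarrow> compactin Y (K F)) \<and>
         (\<Union>F\<in>{F. compactin M F}. K F) = topspace Y \<and>
         (\<forall>F F'. compactin M F \<longrightarrow> compactin M F' \<longrightarrow> F \<subseteq> F' \<longrightarrow> K F \<subseteq> K F'))"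

definition has_diagonal :: "'m topology \<Rightarrow> 'a topology \<Rightarrow> bool"
  where "has_diagonal M X \<longleftrightarrow>
    dominated_by M
      (subtopology (prod_topology X X)
        (topspace X \<times> topspace X - {(x, x) |x. x \<in> topspace X}))"

end

theory Submission
  imports Defs
begin

text \<open>
  Call a set countably closed if it contains the closures of its countable subsets. For a compact
  \<open>F\<close> with decreasing neighbourhood base \<open>V n\<close>, compact sets \<open>G n \<subseteq> V n\<close> have compact union with
  \<open>F\<close>; hence the cluster points of sequences of finite sets chosen from the sets
  \<open>K_below (V n) = \<Union>{K G | G \<subseteq> V n}\<close> form a countably closed set that stays off the diagonal.

  If every \<open>F\<close> has a neighbourhood \<open>V\<close> such that the closure of \<open>K_below V\<close> misses the diagonal,
  then \<open>X\<^sup>2 - \<Delta>\<close> is \<open>\<sigma>\<close>-compact and \<open>X\<close> is metrizable. Otherwise the set of cluster points is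
  countably closed but not closed, and so \<open>X\<close> contains a countably closed set \<open>\<Omega>\<close> accumulating at a
  point \<open>x \<notin> \<Omega>\<close>. The countably closed subsets of \<open>\<Omega>\<close> accumulating at \<open>x\<close> are stable under
  countable decreasing intersections, and each of them, with a point \<open>t\<close> in it, has a subset \<open>T'\<close> of
  the same kind all of whose pairs \<open>(t, u)\<close>, \<open>u \<in> T'\<close>, lie near a single \<open>K F\<close>. Iterating, with the
  sets \<open>F\<close> converging, gives an infinite sequence all of whose pairs lie in a single \<open>K H\<close>,
  which is impossible since \<open>K H\<close> is closed and misses the diagonal.
\<close>

section \<open>Countably closed sets and cluster points\<close>

lemma in_closure_ofD:
  "x \<in> X closure_of S \<Longrightarrow> openin X U \<Longrightarrow> x \<in> U \<Longrightarrow> \<exists>y\<in>S. y \<in> U"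
  unfolding in_closure_of by blast

definition countably_closed_in :: "'a topology \<Rightarrow> 'a set \<Rightarrow> bool"
  where "countably_closed_in Z S \<longleftrightarrow>
    S \<subseteq> topspace Z \<and> (\<forall>A \<subseteq> S. countable A \<longrightarrow> Z closure_of A \<subseteq> S)"

text \<open>The Kuratowski upper limit of the sequence of sets \<open>E n\<close>.\<close>

definition cluster_set :: "'a topology \<Rightarrow> (nat \<Rightarrow> 'a set) \<Rightarrow> 'a set"
  where "cluster_set Z E = (\<Inter>N. Z closure_of (\<Union>n\<in>{N..}. E n))"

text \<open>Finiteness of the selections serves twice: finitely many witnessing compact sets unite
  to one, and finitely many selections merge into one, which yields countable closedness.\<close>

definition cluster_points :: "'a topology \<Rightarrow> (nat \<Rightarrow> 'a set) \<Rightarrow> 'a set"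
  where "cluster_points Z C = (\<Union>E\<in>{E. \<forall>n. finite (E n) \<and> E n \<subseteq> C n}. cluster_set Z E)"

lemma closedin_cluster_set: "closedin Z (cluster_set Z E)"
  unfolding cluster_set_def by (rule closedin_Inter) auto

lemma cluster_set_subset_cluster_points:
  assumes "\<And>n. finite (E n)" and "\<And>n. E n \<subseteq> C n"
  shows "cluster_set Z E \<subseteq> cluster_points Z C"
  unfolding cluster_points_def using assms by (intro UN_upper) simp

lemma cluster_pointsE:
  assumes "z \<in> cluster_points Z C"
  obtains E where "\<And>n. finite (E n)" "\<And>n. E n \<subseteq> C n" "z \<in> cluster_set Z E"
  using assms unfolding cluster_points_def by auto

lemma cluster_set_mono:
  assumes "\<And>n. n \<ge> m \<Longrightarrow> E n \<subseteq> E' n"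
  shows "cluster_set Z E \<subseteq> cluster_set Z E'"
proof -
  have "z \<in> Z closure_of (\<Union>n\<in>{N..}. E' n)" if "z \<in> cluster_set Z E" for z N
  proof -
    have "z \<in> Z closure_of (\<Union>n\<in>{max m N..}. E n)"
      using that unfolding cluster_set_def by blast
    moreover have "(\<Union>n\<in>{max m N..}. E n) \<subseteq> (\<Union>n\<in>{N..}. E' n)"
      using assms by fastforce
    ultimately show ?thesis
      using closure_of_mono by blast
  qed
  then show ?thesis
    unfolding cluster_set_def by blast
qed

lemma cluster_set_nonempty:
  assumes "compact_space Z" and "\<And>n. E n \<noteq> {}" and "\<And>n. E n \<subseteq> topspace Z"
  shows "cluster_set Z E \<noteq> {}"
  unfolding cluster_set_def
proof (rule compact_space_imp_nest[OF assms(1)])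
  show "closedin Z (Z closure_of (\<Union>n\<in>{N..}. E n))" for N
    by simp
  show "Z closure_of (\<Union>n\<in>{N..}. E n) \<noteq> {}" for N
  proof -
    have "E N \<subseteq> Z closure_of (\<Union>n\<in>{N..}. E n)"
      using closure_of_subset[of "\<Union>n\<in>{N..}. E n" Z] assms(3) by fastforce
    then show ?thesis
      using assms(2) by blast
  qed
  show "decseq (\<lambda>N. Z closure_of (\<Union>n\<in>{N..}. E n))"
    unfolding decseq_def by (intro allI impI closure_of_mono) fastforce
qed

text \<open>Selecting single points of \<open>G\<close> suffices: compactness gives them a cluster
  point, which stays in the closed \<open>G\<close>.\<close>

lemma cluster_points_meets_closed:
  assumes "compact_space Z" and "closedin Z G" and "\<And>n. G \<inter> C n \<noteq> {}"
  shows "cluster_points Z C \<inter> G \<noteq> {}"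
proof -
  have "\<forall>n. \<exists>u. u \<in> G \<inter> C n"
    using assms(3) by blast
  then obtain e where e: "\<And>n. e n \<in> G \<inter> C n"
    by metis
  have "cluster_set Z (\<lambda>n. {e n}) \<noteq> {}"
    using assms e closedin_subset by (intro cluster_set_nonempty) blast+
  moreover have "cluster_set Z (\<lambda>n. {e n}) \<subseteq> G"
  proof -
    have "cluster_set Z (\<lambda>n. {e n}) \<subseteq> Z closure_of (\<Union>n\<in>{0..}. {e n})"
      unfolding cluster_set_def by blast
    also have "\<dots> \<subseteq> G"
      using e assms(2) by (intro closure_of_minimal) auto
    finally show ?thesis .
  qed
  moreover have "cluster_set Z (\<lambda>n. {e n}) \<subseteq> cluster_points Z C"
    using e by (intro cluster_set_subset_cluster_points) auto
  ultimately show ?thesis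
    by blast
qed

text \<open>A diagonal merge: the selections \<open>E i\<close> for the points of a countable
  \<open>A\<close> combine into one selection \<open>E'\<close>, whose cluster set is closed and
  contains all of \<open>A\<close>.\<close>

lemma countably_closed_in_cluster_points: "countably_closed_in Z (cluster_points Z C)"
  unfolding countably_closed_in_def
proof (intro conjI allI impI)
  show "cluster_points Z C \<subseteq> topspace Z"
    by (meson closedin_cluster_set closedin_subset cluster_pointsE subsetD subsetI)
  fix A assume A: "A \<subseteq> cluster_points Z C" "countable A"
  show "Z closure_of A \<subseteq> cluster_points Z C"
  proof (cases "A = {}")
    case False
    define s where "s = from_nat_into A"
    have s: "range s = A"
      unfolding s_def using range_from_nat_into[OF False A(2)] .
    have "\<exists>E. (\<forall>n. finite (E n) \<and> E n \<subseteq> C n) \<and> s i \<in> cluster_set Z E" for i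
      using A(1) s by (metis cluster_pointsE rangeI subsetD)
    then obtain E where E: "\<And>i n. finite (E i n)" "\<And>i n. E i n \<subseteq> C n" "\<And>i. s i \<in> cluster_set Z (E i)"
      by metis
    \<comment> \<open>\<open>E i\<close> enters only from index \<open>i\<close> on: this keeps
      \<open>E' n\<close> finite, and cluster sets depend on tails only.\<close>
    define E' where "E' n = (\<Union>i\<le>n. E i n)" for n
    have "s i \<in> cluster_set Z E'" for i
      using cluster_set_mono[of i "E i" E' Z] E(3)[of i] unfolding E'_def by blast
    then have "Z closure_of A \<subseteq> cluster_set Z E'"
      using s by (intro closure_of_minimal closedin_cluster_set) blast
    also have "\<dots> \<subseteq> cluster_points Z C"
    proof (rule cluster_set_subset_cluster_points)
      show "finite (E' n)" for n
        unfolding E'_def using E(1) by auto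
      show "E' n \<subseteq> C n" for n
        unfolding E'_def using E(2)[of _ n] by (rule UN_least)
    qed
    finally show ?thesis .
  qed simp
qed

lemma cluster_points_subset:
  assumes "countably_closed_in Z T" and "\<And>n. C n \<subseteq> T"
  shows "cluster_points Z C \<subseteq> T"
proof -
  have "cluster_set Z E \<subseteq> T" if "\<And>n. finite (E n)" "\<And>n. E n \<subseteq> C n" for E
  proof -
    have "cluster_set Z E \<subseteq> Z closure_of (\<Union>n\<in>{0..}. E n)"
      unfolding cluster_set_def by blast
    moreover have "countable (\<Union>n\<in>{0::nat..}. E n)"
      using that(1) by (intro countable_UN) (auto intro: countable_finite)
    moreover have "(\<Union>n\<in>{0..}. E n) \<subseteq> T"
      using that(2) assms(2) by blast
    ultimately show ?thesis
      using assms(1) unfolding countably_closed_in_def by blast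
  qed
  then show ?thesis
    by (blast elim!: cluster_pointsE)
qed

lemma cluster_points_continuous_image:
  assumes "continuous_map Z Z' f" and "\<And>n. f ` C n \<subseteq> C' n" 
  shows "f ` cluster_points Z C \<subseteq> cluster_points Z' C'"
proof -
  have "f z \<in> cluster_points Z' C'"
    if E: "\<And>n. finite (E n)" "\<And>n. E n \<subseteq> C n" and z: "z \<in> cluster_set Z E" for E z
  proof -
    have "f z \<in> Z' closure_of (\<Union>n\<in>{N..}. f ` E n)" for N
      using continuous_map_image_closure_subset[OF assms(1), of "\<Union>n\<in>{N..}. E n"] z
      unfolding cluster_set_def by (simp add: image_UN) blast
    then have "f z \<in> cluster_set Z' (\<lambda>n. f ` E n)"
      unfolding cluster_set_def by blast
    moreover have "f ` E n \<subseteq> C' n" for n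
      using E(2)[of n] assms(2)[of n] by blast
    ultimately show ?thesis
      using cluster_set_subset_cluster_points[of "\<lambda>n. f ` E n" C' Z'] E(1) by blast
  qed
  then show ?thesis
    by (blast elim!: cluster_pointsE)
qed

lemma countably_closed_in_closed_Int:
  assumes "countably_closed_in Z S" and "closedin Z B"
  shows "countably_closed_in Z (S \<inter> B)"
  using assms(1) closure_of_minimal[OF _ assms(2)] unfolding countably_closed_in_def
  by (simp add: le_infI1)

lemma countably_closed_in_Inter:
  assumes "\<And>n::nat. countably_closed_in Z (T n)"
  shows "countably_closed_in Z (\<Inter>n. T n)"
  using assms unfolding countably_closed_in_def by (simp add: INF_lower2 le_INF_iff)

lemma regular_space_closed_neighbourhoodE:
  assumes "regular_space Z" and "openin Z W" and "x \<in> W"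
  obtains U N where "openin Z U" "closedin Z N" "x \<in> U" "U \<subseteq> N" "N \<subseteq> W"
  using assms unfolding neighbourhood_base_of_closedin[symmetric] neighbourhood_base_of by meson

text \<open>Closed neighbourhoods are the test sets because
  \<open>cluster_points_meets_closed\<close> requires a closed set.\<close>

lemma in_closure_of_closed_neighbourhoods:
  assumes "regular_space Z" and "x \<in> topspace Z"
  shows "x \<in> Z closure_of S \<longleftrightarrow>
    (\<forall>U N. openin Z U \<longrightarrow> closedin Z N \<longrightarrow> x \<in> U \<longrightarrow> U \<subseteq> N \<longrightarrow> S \<inter> N \<noteq> {})"
proof
  assume "x \<in> Z closure_of S"
  then show "\<forall>U N. openin Z U \<longrightarrow> closedin Z N \<longrightarrow> x \<in> U \<longrightarrow> U \<subseteq> N \<longrightarrow> S \<inter> N \<noteq> {}"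
    unfolding in_closure_of by blast
next
  assume *: "\<forall>U N. openin Z U \<longrightarrow> closedin Z N \<longrightarrow> x \<in> U \<longrightarrow> U \<subseteq> N \<longrightarrow> S \<inter> N \<noteq> {}"
  show "x \<in> Z closure_of S"
    unfolding in_closure_of
  proof (intro conjI allI impI)
    fix W assume "x \<in> W \<and> openin Z W"
    then obtain U N where N: "openin Z U" "closedin Z N" "x \<in> U" "U \<subseteq> N" "N \<subseteq> W"
      using regular_space_closed_neighbourhoodE[OF assms(1)] by metis
    then have "S \<inter> N \<noteq> {}"
      using * by simp
    then show "\<exists>y. y \<in> S \<and> y \<in> W"
      using N(5) by blast
  qed (use assms in simp)
qed

text \<open>Every closed neighbourhood of \<open>x\<close> meets all \<open>T n\<close>, so it
  contains a cluster point of selections from them; such a point lies in each \<open>T m\<close>, as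
  dropping the first \<open>m\<close> terms of a selection keeps its cluster points.\<close>

lemma in_closure_of_decreasing_Inter:
  assumes "compact_space Z" and "regular_space Z" and "x \<in> topspace Z"
    and T: "\<And>n. countably_closed_in Z (T n)" "decseq T" "\<And>n. x \<in> Z closure_of (T n)"
  shows "x \<in> Z closure_of (\<Inter>n. T n)"
  unfolding in_closure_of_closed_neighbourhoods[OF assms(2,3)]
proof (intro allI impI)
  fix U N assume N: "openin Z U" "closedin Z N" "x \<in> U" "U \<subseteq> N"
  then have "N \<inter> T n \<noteq> {}" for n
    using T(3)[of n] unfolding in_closure_of_closed_neighbourhoods[OF assms(2,3)] by blast
  then have "cluster_points Z T \<inter> N \<noteq> {}"
    using N assms(1) by (intro cluster_points_meets_closed) auto
  moreover have "cluster_points Z T \<subseteq> T m" for m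
  proof -
    have "cluster_points Z T \<subseteq> cluster_points Z (\<lambda>n. T (n + m))"
    proof -
      have "cluster_set Z E \<subseteq> cluster_points Z (\<lambda>n. T (n + m))"
        if E: "\<And>n. finite (E n)" "\<And>n. E n \<subseteq> T n" for E
      proof -
        have "z \<in> cluster_set Z (\<lambda>n. E (n + m))" if "z \<in> cluster_set Z E" for z
        proof -
          have "(\<Union>n\<in>{N + m..}. E n) \<subseteq> (\<Union>n\<in>{N..}. E (n + m))" for N
          proof
            fix y assume "y \<in> (\<Union>n\<in>{N + m..}. E n)"
            then obtain n where "n \<ge> N + m" "y \<in> E n" by auto
            then show "y \<in> (\<Union>n\<in>{N..}. E (n + m))"
              by (intro UN_I[of "n - m"]) auto
          qed
          then show ?thesis
            using that closure_of_mono unfolding cluster_set_def by blast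
        qed
        then show ?thesis
          using E cluster_set_subset_cluster_points[of "\<lambda>n. E (n + m)" "\<lambda>n. T (n + m)" Z]
          by blast
      qed
      then show ?thesis
        by (blast elim!: cluster_pointsE)
    qed
    also have "\<dots> \<subseteq> T m"
      using T(1,2) by (intro cluster_points_subset) (auto simp: decseq_def)
    finally show ?thesis .
  qed
  ultimately show "(\<Inter>n. T n) \<inter> N \<noteq> {}"
    by blast
qed

text \<open>A non-closed point \<open>(y, z)\<close> of \<open>S\<close> is either seen in the section of \<open>S\<close> at \<open>y\<close>, or
  \<open>y\<close> is a non-closed point of the projection of \<open>S\<close> restricted to a closed strip around \<open>z\<close>.\<close>

lemma countably_closed_in_prod_imp_closedin:
  assumes "compact_space X" and "Hausdorff_space X" and "regular_space X"
    and closed: "\<And>T. countably_closed_in X T \<Longrightarrow> closedin X T"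
    and S: "countably_closed_in (prod_topology X X) S"
  shows "closedin (prod_topology X X) S"
proof -
  have sub: "S \<subseteq> topspace X \<times> topspace X"
    using S unfolding countably_closed_in_def by simp
  have "(y, z) \<in> S" if yz: "(y, z) \<in> prod_topology X X closure_of S" for y z
  proof (rule ccontr)
    assume nS: "(y, z) \<notin> S"
    have y: "y \<in> topspace X" and z: "z \<in> topspace X"
      using yz by (auto simp: in_closure_of)
    have cm: "continuous_map X (prod_topology X X) (Pair y)"
      using y by (simp add: continuous_map_pairedI)
    have "countably_closed_in X {b \<in> topspace X. (y, b) \<in> S}"
      unfolding countably_closed_in_def
    proof (intro conjI allI impI)
      fix A assume A: "A \<subseteq> {b \<in> topspace X. (y, b) \<in> S}" "countable A"
      then have "Pair y ` A \<subseteq> S" and "countable (Pair y ` A)"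
        by auto
      then have "prod_topology X X closure_of (Pair y ` A) \<subseteq> S"
        using S unfolding countably_closed_in_def by simp
      then have "Pair y ` (X closure_of A) \<subseteq> S"
        using continuous_map_image_closure_subset[OF cm, of A] by (rule order_trans[rotated])
      then show "X closure_of A \<subseteq> {b \<in> topspace X. (y, b) \<in> S}"
        using closure_of_subset_topspace[of X A] by auto
    qed auto
    then have "closedin X {b \<in> topspace X. (y, b) \<in> S}"
      by (rule closed)
    then have "openin X (topspace X - {b \<in> topspace X. (y, b) \<in> S})"
      by blast
    moreover have "z \<in> topspace X - {b \<in> topspace X. (y, b) \<in> S}"
      using z nS by blast
    ultimately obtain U B where B: "openin X U" "closedin X B" "z \<in> U" "U \<subseteq> B"
      "B \<subseteq> topspace X - {b \<in> topspace X. (y, b) \<in> S}"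
      by (rule regular_space_closed_neighbourhoodE[OF assms(3)])
    define P where "P = fst ` (S \<inter> (topspace X \<times> B))"
    have cS: "countably_closed_in (prod_topology X X) (S \<inter> (topspace X \<times> B))"
      using B S by (intro countably_closed_in_closed_Int) (auto simp: closedin_prod_Times_iff)
    have "countably_closed_in X P"
      unfolding countably_closed_in_def
    proof (intro conjI allI impI)
      show "P \<subseteq> topspace X"
        using sub unfolding P_def by auto
      \<comment> \<open>Lift \<open>A\<close> to a countable \<open>A'\<close> in the strip. As
        \<open>fst\<close> is a closed map, the closure of \<open>A\<close> is covered by the image
        of the closure of \<open>A'\<close>, which stays in the strip part of
        \<open>S\<close>.\<close>
      fix A assume "A \<subseteq> P" "countable A"
      then obtain A' where A': "A' \<subseteq> S \<inter> (topspace X \<times> B)" "countable A'" "A = fst ` A'"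
        unfolding P_def by (meson countable_subset_image)
      have "closed_map (prod_topology X X) X fst"
        using assms(1,2) by (intro continuous_imp_closed_map) (auto simp: compact_space_prod_topology continuous_map_fst)
      then have "closedin X (fst ` (prod_topology X X closure_of A'))"
        unfolding closed_map_def by simp
      moreover have "A' \<subseteq> topspace (prod_topology X X)"
        using A'(1) sub by auto
      then have "A \<subseteq> fst ` (prod_topology X X closure_of A')"
        unfolding A'(3) by (intro image_mono closure_of_subset)
      ultimately have "X closure_of A \<subseteq> fst ` (prod_topology X X closure_of A')"
        by (rule closure_of_minimal[rotated])
      also have "prod_topology X X closure_of A' \<subseteq> S \<inter> (topspace X \<times> B)"
        using cS A' unfolding countably_closed_in_def by simp
      finally show "X closure_of A \<subseteq> P"
        unfolding P_def by (simp add: image_mono)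
    qed
    then have "closedin X P"
      by (rule closed)
    moreover have "y \<notin> P"
      using B(5) unfolding P_def by auto
    \<comment> \<open>This open box around \<open>(y, z)\<close> cannot meet \<open>S\<close>: over
      \<open>U\<close> the points of \<open>S\<close> have their first coordinate in
      \<open>P\<close>.\<close>
    ultimately have W: "(y, z) \<in> (topspace X - P) \<times> U \<and>
        openin (prod_topology X X) ((topspace X - P) \<times> U)"
      using B y by (auto simp: openin_prod_Times_iff)
    obtain p where p: "p \<in> S" "p \<in> (topspace X - P) \<times> U"
      using in_closure_of[THEN iffD1, OF yz, THEN conjunct2, rule_format, OF W] by (elim exE conjE)
    have "(topspace X - P) \<times> U \<subseteq> topspace X \<times> B"
      using B(4) by (intro Sigma_mono) auto
    with p have "p \<in> S \<inter> (topspace X \<times> B)"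
      by (metis IntI subsetD)
    then have "fst p \<in> P"
      unfolding P_def by (rule imageI)
    then show False
      using p by (metis DiffD2 mem_Times_iff)
  qed
  then have "prod_topology X X closure_of S \<subseteq> S"
    by (rule subrelI)
  then show ?thesis
    using sub by (simp add: closure_of_subset_eq[symmetric])
qed

section \<open>Compact sets in second countable spaces\<close>

lemma (in Metric_space) separable_imp_second_countable:
  assumes "separable_space mtopology"
  shows "second_countable mtopology"
proof -
  obtain D where D: "countable D" "D \<subseteq> M" "mtopology closure_of D = M"
    using assms unfolding separable_space_def by auto
  define \<B> where "\<B> = (\<lambda>(x, n). mball x (inverse (real (Suc n)))) ` (D \<times> UNIV)"
  show ?thesis
    unfolding second_countable_def
  proof (intro exI[of _ \<B>] conjI ballI allI impI)
    show "countable \<B>"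
      unfolding \<B>_def using D(1) by (intro countable_image countable_SIGMA) auto
    show "openin mtopology V" if "V \<in> \<B>" for V
      using that unfolding \<B>_def by auto
    fix U x assume "openin mtopology U \<and> x \<in> U"
    then obtain r where r: "r > 0" "mball x r \<subseteq> U" and x: "x \<in> M"
      unfolding openin_mtopology by blast
    obtain n where n: "inverse (real (Suc n)) < r / 2"
      using reals_Archimedean[of "r / 2"] r(1) by auto
    have "x \<in> mtopology closure_of D"
      using x D(3) by simp
    moreover have "0 < inverse (real (Suc n))"
      by simp
    ultimately obtain y where y: "y \<in> D" "y \<in> mball x (inverse (real (Suc n)))"
      unfolding metric_closure_of by blast
    have "mball y (inverse (real (Suc n))) \<subseteq> mball x r"
    proof
      fix z assume z: "z \<in> mball y (inverse (real (Suc n)))"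
      have "d x z \<le> d x y + d y z"
        using x y z by (intro triangle) auto
      then show "z \<in> mball x r"
        using x y z n by auto
    qed
    moreover have "x \<in> mball y (inverse (real (Suc n)))"
      using x y commute by auto
    ultimately show "\<exists>V\<in>\<B>. x \<in> V \<and> V \<subseteq> U"
      using y(1) r(2) unfolding \<B>_def by (intro bexI[of _ "mball y (inverse (real (Suc n)))"]) auto
  qed
qed

text \<open>Finite unions of members of a countable base are still countably many, and by
  compactness they approximate compact sets from outside.\<close>

lemma second_countable_compact_base:
  assumes "second_countable M"
  obtains \<U> where "countable \<U>" "\<And>U. U \<in> \<U> \<Longrightarrow> openin M U"
    "\<And>F V. compactin M F \<Longrightarrow> openin M V \<Longrightarrow> F \<subseteq> V \<Longrightarrow> \<exists>U\<in>\<U>. F \<subseteq> U \<and> U \<subseteq> V"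
proof -
  obtain \<B> where \<B>: "countable \<B>" "\<And>V. V \<in> \<B> \<Longrightarrow> openin M V"
    "\<And>U x. openin M U \<Longrightarrow> x \<in> U \<Longrightarrow> \<exists>V\<in>\<B>. x \<in> V \<and> V \<subseteq> U"
    using assms unfolding second_countable_def by metis
  show thesis
  proof
    show "countable (Union ` {\<F>. finite \<F> \<and> \<F> \<subseteq> \<B>})"
      using countable_Collect_finite_subset[OF \<B>(1)] by simp
    show "openin M U" if "U \<in> Union ` {\<F>. finite \<F> \<and> \<F> \<subseteq> \<B>}" for U
      using that \<B>(2) by auto
    fix F V assume F: "compactin M F" "openin M V" "F \<subseteq> V"
    have "F \<subseteq> \<Union>{B \<in> \<B>. B \<subseteq> V}"
      using \<B>(3)[OF F(2)] F(3) by blast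
    then obtain \<F> where "finite \<F>" "\<F> \<subseteq> {B \<in> \<B>. B \<subseteq> V}" "F \<subseteq> \<Union>\<F>"
      using compactinD[OF F(1), of "{B \<in> \<B>. B \<subseteq> V}"] \<B>(2) by auto
    then show "\<exists>U\<in>Union ` {\<F>. finite \<F> \<and> \<F> \<subseteq> \<B>}. F \<subseteq> U \<and> U \<subseteq> V"
      by (intro bexI[of _ "\<Union>\<F>"]) auto
  qed
qed

lemma compactin_decreasing_base:
  assumes "second_countable M" and F: "compactin M F"
  obtains V :: "nat \<Rightarrow> 'a set" where "decseq V" "\<And>n. openin M (V n)" "\<And>n. F \<subseteq> V n"
    "\<And>W. openin M W \<Longrightarrow> F \<subseteq> W \<Longrightarrow> \<exists>n. V n \<subseteq> W"
proof -
  obtain \<U> where \<U>: "countable \<U>" "\<And>U. U \<in> \<U> \<Longrightarrow> openin M U"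
    "\<And>F V. compactin M F \<Longrightarrow> openin M V \<Longrightarrow> F \<subseteq> V \<Longrightarrow> \<exists>U\<in>\<U>. F \<subseteq> U \<and> U \<subseteq> V"
    using second_countable_compact_base[OF assms(1)] by metis
  define \<V> where "\<V> = {U \<in> \<U>. F \<subseteq> U}"
  have "\<V> \<noteq> {}"
    using \<U>(3)[OF F openin_topspace] compactin_subset_topspace[OF F] unfolding \<V>_def by blast
  moreover have "countable \<V>"
    unfolding \<V>_def using \<U>(1) by simp
  ultimately have u: "range (from_nat_into \<V>) = \<V>"
    by (rule range_from_nat_into)
  show thesis
  proof
    let ?V = "\<lambda>n. \<Inter>i\<le>n. from_nat_into \<V> i"
    show "decseq ?V"
      unfolding decseq_def by (intro allI impI INF_superset_mono) auto
    show "openin M (?V n)" for n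
      using u \<U>(2) unfolding \<V>_def by (intro openin_INT2) auto
    show "F \<subseteq> ?V n" for n
      using u unfolding \<V>_def by auto
    show "\<exists>n. ?V n \<subseteq> W" if W: "openin M W" "F \<subseteq> W" for W
    proof -
      obtain U where U: "U \<in> \<V>" "U \<subseteq> W"
        using \<U>(3)[OF F W] unfolding \<V>_def by blast
      then obtain n where "U = from_nat_into \<V> n"
        using u by (metis imageE)
      then have "?V n \<subseteq> W"
        using U(2) by auto
      then show ?thesis
        by blast
    qed
  qed
qed

text \<open>A finite subcover of \<open>F\<close> already covers some \<open>V m\<close>, hence all
  \<open>G n\<close> with \<open>n \<ge> m\<close>; the finitely many remaining \<open>G n\<close>
  have compact union.\<close>

lemma compactin_Un_shrinking:
  assumes F: "compactin M F"
    and base: "\<And>W. openin M W \<Longrightarrow> F \<subseteq> W \<Longrightarrow> \<exists>n. V n \<subseteq> W"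
    and "decseq V" and G: "\<And>n. compactin M (G n)" "\<And>n. G n \<subseteq> V n"
  shows "compactin M (F \<union> (\<Union>n. G n))"
  unfolding compactin_def
proof (intro conjI allI impI)
  show "F \<union> (\<Union>n. G n) \<subseteq> topspace M"
    using F G(1) compactin_subset_topspace by blast
  fix \<O> assume \<O>: "(\<forall>U\<in>\<O>. openin M U) \<and> F \<union> (\<Union>n. G n) \<subseteq> \<Union>\<O>"
  then obtain \<F> where \<F>: "finite \<F>" "\<F> \<subseteq> \<O>" "F \<subseteq> \<Union>\<F>"
    using compactinD[OF F, of \<O>] by auto
  then have "openin M (\<Union>\<F>)"
    using \<O> by blast
  then obtain m where m: "V m \<subseteq> \<Union>\<F>"
    using base \<F>(3) by blast
  have "compactin M (\<Union>n<m. G n)"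
    using G(1) by (intro compactin_Union) auto
  then obtain \<F>' where \<F>': "finite \<F>'" "\<F>' \<subseteq> \<O>" "(\<Union>n<m. G n) \<subseteq> \<Union>\<F>'"
    using compactinD[of M "\<Union>n<m. G n" \<O>] \<O> by blast
  have "G n \<subseteq> \<Union>(\<F> \<union> \<F>')" for n
  proof (cases "n < m")
    case True
    then show ?thesis
      using \<F>'(3) by auto
  next
    case False
    then have "V n \<subseteq> V m"
      using assms(3) by (simp add: decseqD)
    then show ?thesis
      using G(2)[of n] m by auto
  qed
  then show "\<exists>\<F>. finite \<F> \<and> \<F> \<subseteq> \<O> \<and> F \<union> (\<Union>n. G n) \<subseteq> \<Union>\<F>"
    using \<F> \<F>' by (intro exI[of _ "\<F> \<union> \<F>'"]) auto
qed

section \<open>Metrizability of compact spaces\<close>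

text \<open>The sequence of the \<open>f n\<close> embeds \<open>X\<close> into the metrizable space
  of real sequences, a continuous injection of a compact space into a Hausdorff space being an
  embedding.\<close>

lemma metrizable_space_if_countably_many_separate:
  fixes f :: "nat \<Rightarrow> 'a \<Rightarrow> real"
  assumes "compact_space X" and "\<And>n. continuous_map X euclideanreal (f n)"
    and "\<And>x y. x \<in> topspace X \<Longrightarrow> y \<in> topspace X \<Longrightarrow> x \<noteq> y \<Longrightarrow> \<exists>n. f n x \<noteq> f n y"
  shows "metrizable_space X"
proof -
  let ?g = "\<lambda>x n. f n x"
  have met: "metrizable_space (euclidean :: (nat \<Rightarrow> real) topology)"
    by (rule metrizable_space_euclidean)
  have "continuous_map X (powertop_real UNIV) ?g"
    using assms(2) by (simp add: continuous_map_componentwise_UNIV)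
  then have "continuous_map X euclidean ?g"
    by (simp add: euclidean_product_topology)
  moreover have "inj_on ?g (topspace X)"
    using assms(3) by (metis inj_onI)
  ultimately have "embedding_map X euclidean ?g"
    using assms(1) by (intro continuous_imp_embedding_map) auto
  then have "X homeomorphic_space subtopology euclidean (?g ` topspace X)"
    by (rule embedding_map_imp_homeomorphic_space)
  then show ?thesis
    using homeomorphic_metrizable_space metrizable_space_subtopology[OF met] by blast
qed

text \<open>Continuous real functions separate points, so the open sets \<open>O' h\<close> cover
  each compact \<open>C n\<close>; finitely many per \<open>n\<close> suffice, which leaves a
  countable separating family.\<close>

lemma metrizable_space_if_sigma_compact_off_diagonal:
  fixes C :: "nat \<Rightarrow> ('a \<times> 'a) set"
  assumes "compact_space X" and "completely_regular_space X" and "t1_space X"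
    and C: "\<And>n. closedin (prod_topology X X) (C n)"
    and diag: "\<And>n x. (x, x) \<notin> C n"
    and cover: "\<And>x y. x \<in> topspace X \<Longrightarrow> y \<in> topspace X \<Longrightarrow> x \<noteq> y \<Longrightarrow> \<exists>n. (x, y) \<in> C n"
  shows "metrizable_space X"
proof -
  define H where "H = {h :: 'a \<Rightarrow> real. continuous_map X euclideanreal h}"
  define O' where "O' h = {p \<in> topspace (prod_topology X X). h (fst p) - h (snd p) \<in> - {0}}" for h :: "'a \<Rightarrow> real"
  have "\<exists>h\<in>H. h x \<noteq> h y" if xy: "x \<in> topspace X" "y \<in> topspace X" "x \<noteq> y" for x y
  proof -
    have "closedin X {y}"
      using assms(3) xy by (simp add: closedin_t1_singleton)
    then obtain h :: "'a \<Rightarrow> real" where h: "continuous_map X (top_of_set {0..1}) h" "h x = 0" "h ` {y} \<subseteq> {1}"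
      using assms(2) xy unfolding completely_regular_space_def by (metis DiffI singletonD)
    then have "h \<in> H"
      unfolding H_def by (simp add: continuous_map_in_subtopology)
    then show ?thesis
      using h by (intro bexI[of _ h]) auto
  qed
  then have cov: "C n \<subseteq> \<Union>(O' ` H)" for n
    using closedin_subset[OF C[of n]] diag[of _ n] unfolding O'_def by fastforce
  have op: "openin (prod_topology X X) (O' h)" if "h \<in> H" for h
  proof -
    have h: "continuous_map X euclideanreal h"
      using that unfolding H_def by simp
    have "continuous_map (prod_topology X X) euclideanreal (\<lambda>p. h (fst p) - h (snd p))"
      by (intro continuous_map_diff continuous_map_compose[OF continuous_map_fst h, unfolded o_def]
          continuous_map_compose[OF continuous_map_snd h, unfolded o_def])
    then show ?thesis
      unfolding O'_def by (rule openin_continuous_map_preimage) auto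
  qed
  have "\<exists>\<F>. finite \<F> \<and> \<F> \<subseteq> H \<and> C n \<subseteq> \<Union>(O' ` \<F>)" for n
  proof -
    have "compactin (prod_topology X X) (C n)"
      using C assms(1) by (simp add: closedin_compact_space compact_space_prod_topology)
    then have "\<exists>\<G>. finite \<G> \<and> \<G> \<subseteq> O' ` H \<and> C n \<subseteq> \<Union>\<G>"
      by (rule compactinD) (use cov op in auto)
    then obtain \<G> where "finite \<G>" "\<G> \<subseteq> O' ` H" "C n \<subseteq> \<Union>\<G>"
      by metis
    then show ?thesis
      using finite_subset_image[of \<G> O' H] by blast
  qed
  then obtain \<F> where \<F>: "\<And>n. finite (\<F> n)" "\<And>n. \<F> n \<subseteq> H" "\<And>n. C n \<subseteq> \<Union>(O' ` \<F> n)"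
    by metis
  \<comment> \<open>The constant function keeps \<open>J\<close> nonempty, so that
    \<open>from_nat_into\<close> enumerates exactly \<open>J\<close>.\<close>
  define J where "J = insert (\<lambda>_. 0) (\<Union>n. \<F> n)"
  have "J \<subseteq> H"
    unfolding J_def using \<F>(2) by (auto simp: H_def)
  have J: "range (from_nat_into J) = J"
    unfolding J_def using \<F>(1) by (intro range_from_nat_into) (auto intro: countable_finite)
  show ?thesis
  proof (rule metrizable_space_if_countably_many_separate[OF assms(1)])
    show "continuous_map X euclideanreal (from_nat_into J n)" for n
      using J \<open>J \<subseteq> H\<close> unfolding H_def by blast
    fix x y assume "x \<in> topspace X" "y \<in> topspace X" "x \<noteq> y"
    then obtain n where "(x, y) \<in> C n"
      using cover by blast
    then obtain h where "h \<in> \<F> n" "(x, y) \<in> O' h"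
      using \<F>(3) by blast
    then have "h \<in> J" "h x \<noteq> h y"
      unfolding J_def O'_def by auto
    then show "\<exists>n. from_nat_into J n x \<noteq> from_nat_into J n y"
      using J by (metis imageE)
  qed
qed

section \<open>Compact covers of the complement of the diagonal\<close>

text \<open>An \<open>M\<close>-diagonal of a compact Hausdorff space, restated with closed subsets
  of the full square so that closures can be taken there; of the metric on \<open>M\<close> its
  second countability is kept.\<close>

locale off_diagonal_cover =
  fixes X :: "'a topology" and M :: "'m topology" and K :: "'m set \<Rightarrow> ('a \<times> 'a) set"
  assumes compact_space: "compact_space X" and Hausdorff_space: "Hausdorff_space X"
    and second_countable: "second_countable M"
    and closedin_K: "\<And>F. compactin M F \<Longrightarrow> closedin (prod_topology X X) (K F)"
    and K_off_diagonal: "\<And>F x. compactin M F \<Longrightarrow> (x, x) \<notin> K F"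
    and K_mono: "\<And>F G. compactin M F \<Longrightarrow> compactin M G \<Longrightarrow> F \<subseteq> G \<Longrightarrow> K F \<subseteq> K G"
    and K_cover: "\<And>x y. x \<in> topspace X \<Longrightarrow> y \<in> topspace X \<Longrightarrow> x \<noteq> y \<Longrightarrow>
      \<exists>F. compactin M F \<and> (x, y) \<in> K F"
begin

lemma regular_space: "regular_space X"
  using compact_space Hausdorff_space by (simp add: compact_Hausdorff_imp_regular_space)

section \<open>Pairs witnessed near a compact set\<close>

definition K_below :: "'m set \<Rightarrow> ('a \<times> 'a) set"
  where "K_below V = (\<Union>G\<in>{G. compactin M G \<and> G \<subseteq> V}. K G)"

text \<open>Witnesses need only lie arbitrarily close to \<open>F\<close>. This relaxation of
  \<open>K F\<close> receives cluster points and, for compact \<open>F\<close>, still avoids the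
  diagonal.\<close>

definition K_near :: "'m set \<Rightarrow> ('a \<times> 'a) set"
  where "K_near F = (\<Inter>V\<in>{V. openin M V \<and> F \<subseteq> V}. K_below V)"

lemma K_below_mono: "V \<subseteq> W \<Longrightarrow> K_below V \<subseteq> K_below W"
  unfolding K_below_def by (intro UN_mono) auto

lemma K_below_subset: "K_below V \<subseteq> topspace (prod_topology X X)"
  unfolding K_below_def using closedin_subset[OF closedin_K] by (intro UN_least) auto

lemma K_belowI: "compactin M G \<Longrightarrow> G \<subseteq> V \<Longrightarrow> p \<in> K G \<Longrightarrow> p \<in> K_below V"
  unfolding K_below_def by auto

lemma K_belowE:
  assumes "p \<in> K_below V"
  obtains G where "compactin M G" "G \<subseteq> V" "p \<in> K G"
  using assms unfolding K_below_def by auto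

lemma K_nearD: "p \<in> K_near F \<Longrightarrow> openin M V \<Longrightarrow> F \<subseteq> V \<Longrightarrow> p \<in> K_below V"
  unfolding K_near_def by auto

lemma diagonal_notin_K_near: "compactin M F \<Longrightarrow> (x, x) \<notin> K_near F"
  using K_nearD[OF _ openin_topspace compactin_subset_topspace] K_off_diagonal
  by (metis K_belowE)

text \<open>Each finite \<open>E n\<close> lies in one \<open>K (G n)\<close> with
  \<open>G n\<close> inside \<open>V n\<close>, by monotonicity. Since \<open>F\<close> and the
  \<open>G n\<close> have compact union, a single closed \<open>K H\<close> contains a tail of
  \<open>E\<close> and hence its cluster points.\<close>

lemma cluster_points_K_below:
  assumes F: "compactin M F" and "decseq V"
    and base: "\<And>W. openin M W \<Longrightarrow> F \<subseteq> W \<Longrightarrow> \<exists>n. V n \<subseteq> W"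
  shows "cluster_points (prod_topology X X) (\<lambda>n. K_below (V n)) \<subseteq> K_near F"
proof
  fix p assume "p \<in> cluster_points (prod_topology X X) (\<lambda>n. K_below (V n))"
  then obtain E where E: "\<And>n. finite (E n)" "\<And>n. E n \<subseteq> K_below (V n)"
    and p: "p \<in> cluster_set (prod_topology X X) E"
    by (rule cluster_pointsE) blast
  have "\<exists>G. compactin M G \<and> G \<subseteq> V n \<and> E n \<subseteq> K G" for n
  proof -
    have "\<forall>e\<in>E n. \<exists>G. compactin M G \<and> G \<subseteq> V n \<and> e \<in> K G"
      using E(2)[of n] by (meson K_belowE subsetD)
    then obtain g where g: "\<And>e. e \<in> E n \<Longrightarrow> compactin M (g e) \<and> g e \<subseteq> V n \<and> e \<in> K (g e)"
      by metis
    have c: "compactin M (\<Union>e\<in>E n. g e)"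
      using g E(1) by (intro compactin_Union) auto
    moreover have "E n \<subseteq> K (\<Union>e\<in>E n. g e)"
      using g K_mono[OF _ c] by (meson UN_upper subsetD subsetI)
    ultimately show ?thesis
      using g by (meson UN_least)
  qed
  then obtain G where G: "\<And>n. compactin M (G n)" "\<And>n. G n \<subseteq> V n" "\<And>n. E n \<subseteq> K (G n)"
    by metis
  have "p \<in> K_below W" if W: "openin M W" "F \<subseteq> W" for W
  proof -
    obtain m where m: "V m \<subseteq> W"
      using base[OF W] by blast
    have V: "V (n + m) \<subseteq> V n" "V (n + m) \<subseteq> V m" for n
      using \<open>decseq V\<close> by (simp_all add: decseqD)
    \<comment> \<open>The shift by \<open>m\<close> drops the early \<open>G n\<close>, which may
      stick out of \<open>W\<close>.\<close>
    define H where "H = F \<union> (\<Union>n. G (n + m))"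
    have H: "compactin M H"
      unfolding H_def using G(1) order_trans[OF G(2) V(1)]
      by (intro compactin_Un_shrinking[OF F base \<open>decseq V\<close>])
    have "H \<subseteq> W"
      unfolding H_def using W(2) order_trans[OF order_trans[OF G(2) V(2)] m] by blast
    have "E n \<subseteq> K H" if "n \<ge> m" for n
    proof -
      have "G n \<subseteq> H"
        unfolding H_def using UN_upper[of "n - m" UNIV "\<lambda>n. G (n + m)"] that by auto
      then show ?thesis
        using G(3) K_mono[OF G(1) H] by blast
    qed
    then have "(\<Union>n\<in>{m..}. E n) \<subseteq> K H"
      by (intro UN_least) simp
    then have "prod_topology X X closure_of (\<Union>n\<in>{m..}. E n) \<subseteq> K H"
      by (rule closure_of_minimal[OF _ closedin_K[OF H]])
    then have "p \<in> K H"
      using p unfolding cluster_set_def by blast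
    then show ?thesis
      using H \<open>H \<subseteq> W\<close> by (intro K_belowI)
  qed
  then show "p \<in> K_near F"
    unfolding K_near_def by simp
qed

text \<open>Collecting witnesses for the pairs with a given left end shrinks to \<open>F j\<close>, and the
  collections for varying \<open>j\<close> shrink to the base point of \<open>V\<close>; so one compact set
  witnesses all pairs, and a cluster point of \<open>t\<close> lands on the diagonal.\<close>

lemma no_infinite_clique:
  fixes t :: "nat \<Rightarrow> 'a"
  assumes F0: "compactin M F0" and V: "decseq V" "\<And>n. openin M (V n)"
    and base: "\<And>W. openin M W \<Longrightarrow> F0 \<subseteq> W \<Longrightarrow> \<exists>n. V n \<subseteq> W"
    and t: "\<And>n. t n \<in> topspace X"
    and F: "\<And>n. compactin M (F n)" "\<And>n. F n \<subseteq> V n"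
    and near: "\<And>j k. j < k \<Longrightarrow> (t j, t k) \<in> K_near (F j)"
  shows False
proof -
  have "\<exists>H. compactin M H \<and> H \<subseteq> V j \<and> (\<forall>k>j. (t j, t k) \<in> K H)" for j
  proof -
    obtain W where W: "decseq W" "\<And>n. openin M (W n)" "\<And>n. F j \<subseteq> W n"
      "\<And>U. openin M U \<Longrightarrow> F j \<subseteq> U \<Longrightarrow> \<exists>n. W n \<subseteq> U"
      using compactin_decreasing_base[OF second_countable F(1)] by metis
    \<comment> \<open>The witnesses are confined to \<open>W k\<close> so that they shrink to
      \<open>F j\<close>, and to \<open>V j\<close> so that the resulting \<open>H j\<close> shrink
      to \<open>F0\<close>. For \<open>k \<le> j\<close> the empty set is a filler.\<close>
    have "\<exists>G. compactin M G \<and> G \<subseteq> W k \<inter> V j \<and> (j < k \<longrightarrow> (t j, t k) \<in> K G)" for k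
    proof (cases "j < k")
      case True
      have "(t j, t k) \<in> K_below (W k \<inter> V j)"
        using W(2,3) V(2) F(2) by (intro K_nearD[OF near[OF True]]) auto
      then show ?thesis
        by (metis K_belowE)
    next
      case False
      then show ?thesis
        by (intro exI[of _ "{}"]) auto
    qed
    then obtain G where G: "\<And>k. compactin M (G k)" "\<And>k. G k \<subseteq> W k \<inter> V j"
      "\<And>k. j < k \<Longrightarrow> (t j, t k) \<in> K (G k)"
      by metis
    let ?H = "F j \<union> (\<Union>k. G k)"
    have H: "compactin M ?H"
      using G(1,2) by (intro compactin_Un_shrinking[OF F(1) W(4) W(1)]) auto
    moreover have "?H \<subseteq> V j"
      using F(2)[of j] G(2) by blast
    moreover have "(t j, t k) \<in> K ?H" if "j < k" for k
      using G(3)[OF that] K_mono[OF G(1)[of k] H] by blast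
    ultimately show ?thesis
      by blast
  qed
  then obtain H where H: "\<And>j. compactin M (H j)" "\<And>j. H j \<subseteq> V j"
    "\<And>j k. j < k \<Longrightarrow> (t j, t k) \<in> K (H j)"
    by metis
  let ?L = "F0 \<union> (\<Union>j. H j)"
  have L: "compactin M ?L"
    using H(1,2) by (intro compactin_Un_shrinking[OF F0 base V(1)])
  have tt: "(t j, t k) \<in> K ?L" if "j < k" for j k
    using H(3)[OF that] K_mono[OF H(1)[of j] L] by blast
  obtain z where z: "z \<in> cluster_set X (\<lambda>n. {t n})"
    using cluster_set_nonempty[OF compact_space, of "\<lambda>n. {t n}"] t by auto
  have frequently: "\<exists>n\<ge>N. t n \<in> U" if "openin X U" "z \<in> U" for U N
  proof -
    have "z \<in> X closure_of (\<Union>n\<in>{N..}. {t n})"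
      using z unfolding cluster_set_def by blast
    then have "\<exists>y\<in>(\<Union>n\<in>{N..}. {t n}). y \<in> U"
      using that by (rule in_closure_ofD)
    then show ?thesis
      by auto
  qed
  have "(z, z) \<in> prod_topology X X closure_of (K ?L)"
    unfolding in_closure_of
  proof (intro conjI allI impI)
    show "(z, z) \<in> topspace (prod_topology X X)"
      using z closedin_subset[OF closedin_cluster_set, of X "\<lambda>n. {t n}"] by auto
    fix T assume T: "(z, z) \<in> T \<and> openin (prod_topology X X) T"
    obtain U U' where U: "openin X U" "openin X U'" "z \<in> U" "z \<in> U'" "U \<times> U' \<subseteq> T"
      using T[THEN conjunct2, unfolded openin_prod_topology_alt, rule_format, OF T[THEN conjunct1]]
      by (elim exE conjE)
    \<comment> \<open>First \<open>j\<close>, then a later \<open>k\<close>: only pairs in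
      increasing order are known to lie in \<open>K ?L\<close>.\<close>
    obtain j where j: "t j \<in> U"
      using frequently[OF U(1,3)] by blast
    obtain k where k: "k \<ge> Suc j" "t k \<in> U'"
      using frequently[OF U(2,4)] by blast
    then show "\<exists>y. y \<in> K ?L \<and> y \<in> T"
      using tt[of j k] j U(5) by (intro exI[of _ "(t j, t k)"]) auto
  qed
  then have "(z, z) \<in> K ?L"
    using closedin_K[OF L] by (simp add: closure_of_closedin)
  then show False
    using K_off_diagonal[OF L] by blast
qed

section \<open>Countably closed sets accumulating at an outside point\<close>

definition accumulates_at :: "'a \<Rightarrow> 'a set \<Rightarrow> bool"
  where "accumulates_at x T \<longleftrightarrow> countably_closed_in X T \<and> x \<notin> T \<and> x \<in> X closure_of T"

text \<open>This completeness allows countably many shrinking requirements to be met by one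
  set.\<close>

lemma accumulates_at_Inter:
  assumes "decseq T" and "\<And>n. accumulates_at x (T n)"
  shows "accumulates_at x (\<Inter>n. T n)"
proof -
  have "x \<in> topspace X"
    using assms(2) unfolding accumulates_at_def by (meson in_closure_of)
  then show ?thesis
    using assms countably_closed_in_Inter
      in_closure_of_decreasing_Inter[OF compact_space regular_space]
    unfolding accumulates_at_def by blast
qed

lemma accumulates_at_Int_neighbourhood:
  assumes "accumulates_at x T" and "openin X U" and "closedin X N" and "x \<in> U" and "U \<subseteq> N"
  shows "accumulates_at x (T \<inter> N)"
proof -
  have "x \<in> X closure_of (T \<inter> N)"
    unfolding in_closure_of
  proof (intro conjI allI impI)
    show "x \<in> topspace X"
      using assms openin_subset by blast
    fix W assume "x \<in> W \<and> openin X W"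
    then have "openin X (W \<inter> U)" and "x \<in> W \<inter> U"
      using assms by auto
    then obtain y where "y \<in> T" "y \<in> W \<inter> U"
      using assms(1) in_closure_ofD unfolding accumulates_at_def by metis
    then show "\<exists>y. y \<in> T \<inter> N \<and> y \<in> W"
      using assms(5) by blast
  qed
  then show ?thesis
    using assms countably_closed_in_closed_Int unfolding accumulates_at_def by blast
qed

text \<open>The intersection of all \<open>N n\<close> need not be a neighbourhood of
  \<open>x\<close>; the finite stages are, and \<open>accumulates_at_Inter\<close> passes to the
  limit.\<close>

lemma accumulates_at_Int_countably_many_neighbourhoods:
  fixes N :: "nat \<Rightarrow> 'a set"
  assumes T: "accumulates_at x T" and N: "\<And>n. openin X (U n)" "\<And>n. closedin X (N n)"
    "\<And>n. x \<in> U n" "\<And>n. U n \<subseteq> N n"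
  shows "accumulates_at x (\<Inter>n. T \<inter> (\<Inter>i\<le>n. N i))"
proof (rule accumulates_at_Inter)
  show "decseq (\<lambda>n. T \<inter> (\<Inter>i\<le>n. N i))"
    unfolding decseq_def by (intro allI impI Int_mono INF_superset_mono) auto
  show "accumulates_at x (T \<inter> (\<Inter>i\<le>n. N i))" for n
  proof (rule accumulates_at_Int_neighbourhood[OF T])
    show "openin X (\<Inter>i\<le>n. U i)"
      using N(1) by (intro openin_INT2) auto
    show "closedin X (\<Inter>i\<le>n. N i)"
      using N(2) by (intro closedin_INT) auto
    show "(\<Inter>i\<le>n. U i) \<subseteq> (\<Inter>i\<le>n. N i)"
      using N(4) by (intro INF_mono) auto
  qed (use N(3) in auto)
qed

text \<open>First shrink \<open>T\<close> around \<open>x\<close> to avoid every \<open>A U\<close>,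
  \<open>U\<close> basic, whose closure misses \<open>x\<close>. A surviving point \<open>u\<close>
  gives \<open>F\<close> with \<open>(t, u)\<close> in \<open>K F\<close>; each basic
  \<open>U\<close> containing \<open>F\<close> has \<open>u\<close> in \<open>A U\<close>, so
  \<open>x\<close> is in the closure of \<open>A U\<close>. The cluster points of the
  \<open>A (V n)\<close> then form the required \<open>T'\<close>.\<close>

lemma accumulating_subset_of_section:
  assumes T: "accumulates_at x T" and t: "t \<in> T"
  shows "\<exists>F T'. compactin M F \<and> T' \<subseteq> T \<and> accumulates_at x T' \<and> (\<forall>u\<in>T'. (t, u) \<in> K_near F)"
proof -
  have x: "x \<in> topspace X" and Tt: "T \<subseteq> topspace X" and "x \<noteq> t"
    using T t unfolding accumulates_at_def countably_closed_in_def by (auto simp: in_closure_of)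
  define A where "A V = {v \<in> T. (t, v) \<in> K_below V}" for V
  obtain \<U> where \<U>: "countable \<U>" "\<And>U. U \<in> \<U> \<Longrightarrow> openin M U"
    "\<And>F V. compactin M F \<Longrightarrow> openin M V \<Longrightarrow> F \<subseteq> V \<Longrightarrow> \<exists>U\<in>\<U>. F \<subseteq> U \<and> U \<subseteq> V"
    using second_countable_compact_base[OF second_countable] by metis
  let ?U = "from_nat_into \<U>"
  have "\<exists>O' N. openin X O' \<and> closedin X N \<and> x \<in> O' \<and> O' \<subseteq> N \<and> t \<notin> N \<and>
      (x \<notin> X closure_of (A (?U n)) \<longrightarrow> A (?U n) \<inter> N = {})" for n
  proof -
    \<comment> \<open>Removing \<open>t\<close> guarantees \<open>u \<noteq> t\<close> later, so
      that \<open>K_cover\<close> applies.\<close>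
    define W where "W = (topspace X - {t}) -
      (if x \<notin> X closure_of (A (?U n)) then X closure_of (A (?U n)) else {})"
    have "openin X (topspace X - {t})"
      using closedin_Hausdorff_singleton[OF Hausdorff_space, of t] t Tt by blast
    then have "openin X W"
      unfolding W_def by (rule openin_diff) auto
    moreover have "x \<in> W"
      unfolding W_def using x \<open>x \<noteq> t\<close> by auto
    ultimately obtain O' N where N: "openin X O'" "closedin X N" "x \<in> O'" "O' \<subseteq> N" "N \<subseteq> W"
      by (rule regular_space_closed_neighbourhoodE[OF regular_space])
    have "A (?U n) \<subseteq> X closure_of (A (?U n))"
      using Tt unfolding A_def by (intro closure_of_subset) auto
    then have "A (?U n) \<inter> N = {}" if "x \<notin> X closure_of (A (?U n))"
      using that N(5) unfolding W_def by auto
    moreover have "t \<notin> N"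
      using N(5) unfolding W_def by auto
    ultimately show ?thesis
      using N by (intro exI[of _ O'] exI[of _ N]) simp
  qed
  then obtain O' N where N: "\<And>n. openin X (O' n)" "\<And>n. closedin X (N n)"
    "\<And>n. x \<in> O' n" "\<And>n. O' n \<subseteq> N n" "\<And>n. t \<notin> N n"
    "\<And>n. x \<notin> X closure_of (A (?U n)) \<Longrightarrow> A (?U n) \<inter> N n = {}"
    by metis
  have "x \<in> X closure_of (\<Inter>n. T \<inter> (\<Inter>i\<le>n. N i))"
    using accumulates_at_Int_countably_many_neighbourhoods[of x T O' N, OF T N(1-4)]
    unfolding accumulates_at_def by simp
  then obtain u where "u \<in> (\<Inter>n. T \<inter> (\<Inter>i\<le>n. N i))"
    by (metis closure_of_empty ex_in_conv)
  then have u: "u \<in> T" "\<And>n. u \<in> N n"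
    by auto
  then have "u \<noteq> t"
    using N(5) by metis
  then obtain F where F: "compactin M F" "(t, u) \<in> K F"
    using K_cover[of t u] u(1) t Tt by blast
  obtain V where V: "decseq V" "\<And>n. openin M (V n)" "\<And>n. F \<subseteq> V n"
    "\<And>W. openin M W \<Longrightarrow> F \<subseteq> W \<Longrightarrow> \<exists>n. V n \<subseteq> W"
    using compactin_decreasing_base[OF second_countable F(1)] by metis
  have cl: "x \<in> X closure_of (A (V n))" for n
  proof -
    obtain U where U: "U \<in> \<U>" "F \<subseteq> U" "U \<subseteq> V n"
      using \<U>(3)[OF F(1) V(2,3)] by blast
    then obtain m where m: "U = ?U m"
      using range_from_nat_into[of \<U>] \<U>(1) by (metis emptyE imageE)
    have "u \<in> A U"
      unfolding A_def using u(1) K_belowI[OF F(1) U(2) F(2)] by simp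
    then have "x \<in> X closure_of (A U)"
      using N(6)[of m] u(2)[of m] unfolding m by blast
    moreover have "A U \<subseteq> A (V n)"
      unfolding A_def using K_below_mono[OF U(3)] by blast
    ultimately show ?thesis
      using closure_of_mono by blast
  qed
  define S where "S = cluster_points X (\<lambda>n. A (V n))"
  have "S \<subseteq> T"
    unfolding S_def using T unfolding accumulates_at_def
    by (intro cluster_points_subset) (auto simp: A_def)
  moreover have "accumulates_at x S"
    unfolding accumulates_at_def
  proof (intro conjI)
    show "countably_closed_in X S"
      unfolding S_def by (rule countably_closed_in_cluster_points)
    show "x \<notin> S"
      using T \<open>S \<subseteq> T\<close> unfolding accumulates_at_def by blast
    show "x \<in> X closure_of S"
      unfolding in_closure_of_closed_neighbourhoods[OF regular_space x]
    proof (intro allI impI)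
      fix U N' assume N': "openin X U" "closedin X N'" "x \<in> U" "U \<subseteq> N'"
      have "N' \<inter> A (V n) \<noteq> {}" for n
        using cl[of n] N' unfolding in_closure_of_closed_neighbourhoods[OF regular_space x]
        by (metis Int_commute)
      then show "S \<inter> N' \<noteq> {}"
        unfolding S_def by (rule cluster_points_meets_closed[OF compact_space N'(2)])
    qed
  qed
  moreover have "(t, v) \<in> K_near F" if "v \<in> S" for v
  proof -
    have "Pair t ` S \<subseteq> cluster_points (prod_topology X X) (\<lambda>n. K_below (V n))"
      unfolding S_def
    proof (rule cluster_points_continuous_image)
      show "continuous_map X (prod_topology X X) (Pair t)"
        using t Tt by (auto intro!: continuous_map_pairedI)
      show "Pair t ` A (V n) \<subseteq> K_below (V n)" for n
        unfolding A_def by auto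
    qed
    also have "\<dots> \<subseteq> K_near F"
      by (rule cluster_points_K_below[OF F(1) V(1,4)])
    finally show ?thesis
      using that by blast
  qed
  ultimately show ?thesis
    using F(1) by blast
qed

text \<open>One step of a recursion: the chosen point, the compact set near which its pairs with
  later points lie, and the reservoir for those points.\<close>

definition extends_below :: "'a \<Rightarrow> 'm set \<Rightarrow> 'a set \<Rightarrow> 'a \<times> 'm set \<times> 'a set \<Rightarrow> bool"
  where "extends_below x U T s \<longleftrightarrow> (case s of (t, F, T') \<Rightarrow> t \<in> T \<and> compactin M F \<and> F \<subseteq> U \<and>
    T' \<subseteq> T \<and> accumulates_at x T' \<and> (\<forall>u\<in>T'. (t, u) \<in> K_near F))"

lemma extends_below_mono:
  "extends_below x U T s \<Longrightarrow> U \<subseteq> U' \<Longrightarrow> T \<subseteq> T' \<Longrightarrow> extends_below x U' T' s"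
  unfolding extends_below_def by (auto split: prod.splits)

text \<open>Since only countably many \<open>U n\<close> matter, a possible extension below \<open>U n\<close> can be made to persist
  in all smaller sets; a sequence of length \<open>\<omega>\<close> then suffices where one would otherwise
  thin out a sequence of length \<open>\<omega>\<^sub>1\<close>.\<close>

lemma ex_stable_accumulating_subset:
  fixes U :: "nat \<Rightarrow> 'm set"
  assumes "accumulates_at x \<Omega>"
  obtains T where "accumulates_at x T"
    "\<And>n T'. T' \<subseteq> T \<Longrightarrow> accumulates_at x T' \<Longrightarrow> Ex (extends_below x (U n) T) \<Longrightarrow>
      Ex (extends_below x (U n) T')"
proof -
  \<comment> \<open>Stage \<open>n\<close> passes to a subset without extensions below
    \<open>U n\<close> whenever there is one.\<close>
  have "\<exists>T. \<forall>n. accumulates_at x (T n) \<and> (T (Suc n) \<subseteq> T n \<and>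
      ((\<exists>T'\<subseteq>T n. accumulates_at x T' \<and> \<not> Ex (extends_below x (U n) T')) \<longrightarrow>
        \<not> Ex (extends_below x (U n) (T (Suc n)))))"
  proof (rule dependent_nat_choice)
    show "\<exists>T. accumulates_at x T"
      using assms by blast
    show "\<exists>T''. accumulates_at x T'' \<and> (T'' \<subseteq> T \<and>
        ((\<exists>T'\<subseteq>T. accumulates_at x T' \<and> \<not> Ex (extends_below x (U n) T')) \<longrightarrow>
          \<not> Ex (extends_below x (U n) T'')))" if "accumulates_at x T" for T n
      using that by (metis order_refl)
  qed
  then obtain T where T: "\<And>n. accumulates_at x (T n)" "\<And>n. T (Suc n) \<subseteq> T n"
    "\<And>n T'. T' \<subseteq> T n \<Longrightarrow> accumulates_at x T' \<Longrightarrow> \<not> Ex (extends_below x (U n) T') \<Longrightarrow>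
      \<not> Ex (extends_below x (U n) (T (Suc n)))"
    by metis
  show thesis
  proof
    show "accumulates_at x (\<Inter>n. T n)"
      using T(1,2) by (intro accumulates_at_Inter) (auto simp: decseq_Suc_iff)
    fix n T' assume T': "T' \<subseteq> (\<Inter>n. T n)" "accumulates_at x T'"
      "Ex (extends_below x (U n) (\<Inter>n. T n))"
    \<comment> \<open>An extension inside the limit is one inside \<open>T (Suc n)\<close>, so stage
      \<open>n\<close> had no subset without extensions to pass to.\<close>
    have "(\<Inter>n. T n) \<subseteq> T (Suc n)" "(\<Inter>n. T n) \<subseteq> T n"
      by auto
    then have "Ex (extends_below x (U n) (T (Suc n)))" "T' \<subseteq> T n"
      using T'(1,3) extends_below_mono[OF _ order_refl] by blast+
    then show "Ex (extends_below x (U n) T')"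
      using T(3) T'(2) by blast
  qed
qed

text \<open>The extension \<open>(t0, F0, T0)\<close> of the stable set \<open>T\<close> lies below
  every neighbourhood of \<open>F0\<close>, and stability provides extensions below it in all
  accumulating subsets of \<open>T\<close>. Hence the recursion never stops and can demand that the
  \<open>F n\<close> shrink to \<open>F0\<close>, producing the clique excluded by
  \<open>no_infinite_clique\<close>.\<close>

lemma not_accumulates_at: "\<not> accumulates_at x \<Omega>"
proof
  assume "accumulates_at x \<Omega>"
  obtain \<U> where \<U>: "countable \<U>" "\<And>U. U \<in> \<U> \<Longrightarrow> openin M U"
    "\<And>F V. compactin M F \<Longrightarrow> openin M V \<Longrightarrow> F \<subseteq> V \<Longrightarrow> \<exists>U\<in>\<U>. F \<subseteq> U \<and> U \<subseteq> V"
    using second_countable_compact_base[OF second_countable] by metis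
  let ?U = "from_nat_into \<U>"
  obtain T where T: "accumulates_at x T"
    "\<And>n T'. T' \<subseteq> T \<Longrightarrow> accumulates_at x T' \<Longrightarrow> Ex (extends_below x (?U n) T) \<Longrightarrow>
      Ex (extends_below x (?U n) T')"
    using ex_stable_accumulating_subset[OF \<open>accumulates_at x \<Omega>\<close>, of ?U] by metis
  have "x \<in> X closure_of T"
    using T(1) unfolding accumulates_at_def by blast
  then obtain t0 where "t0 \<in> T"
    by (metis closure_of_empty ex_in_conv)
  then obtain F0 T0 where F0: "compactin M F0" and T0: "T0 \<subseteq> T" "accumulates_at x T0"
    "\<forall>u\<in>T0. (t0, u) \<in> K_near F0"
    using accumulating_subset_of_section[OF T(1)] by metis
  obtain V where V: "decseq V" "\<And>n. openin M (V n)" "\<And>n. F0 \<subseteq> V n"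
    "\<And>W. openin M W \<Longrightarrow> F0 \<subseteq> W \<Longrightarrow> \<exists>n. V n \<subseteq> W"
    using compactin_decreasing_base[OF second_countable F0] by metis
  have step: "\<exists>s. extends_below x (V n) T' s" if T': "T' \<subseteq> T" "accumulates_at x T'" for n T'
  proof -
    \<comment> \<open>Stability concerns enumerated sets only, so a basic \<open>U\<close> is put
      between \<open>F0\<close> and \<open>V n\<close>.\<close>
    obtain U where U: "U \<in> \<U>" "F0 \<subseteq> U" "U \<subseteq> V n"
      using \<U>(3)[OF F0 V(2,3)] by blast
    then obtain m where m: "U = ?U m"
      using range_from_nat_into[of \<U>] \<U>(1) by (metis emptyE imageE)
    have "extends_below x U T (t0, F0, T0)"
      unfolding extends_below_def using \<open>t0 \<in> T\<close> F0 T0 U(2) by simp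
    then have "Ex (extends_below x U T')"
      using T(2)[OF T'] unfolding m by blast
    then show ?thesis
      using extends_below_mono[OF _ U(3) order_refl] by blast
  qed
  \<comment> \<open>The first conjunct keeps the reservoirs inside \<open>T\<close>, where
    \<open>step\<close> applies; the second nests them.\<close>
  have "\<exists>s. \<forall>n. extends_below x (V n) T (s n) \<and>
      extends_below x (V (Suc n)) (snd (snd (s n))) (s (Suc n))"
  proof (rule dependent_nat_choice)
    show "\<exists>s. extends_below x (V 0) T s"
      using step[OF order_refl T(1)] .
    fix s n assume s: "extends_below x (V n) T s"
    then have *: "snd (snd s) \<subseteq> T" "accumulates_at x (snd (snd s))"
      unfolding extends_below_def by auto
    show "\<exists>s'. extends_below x (V (Suc n)) T s' \<and> extends_below x (V (Suc n)) (snd (snd s)) s'"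
      using step[OF *, of "Suc n"] extends_below_mono[OF _ order_refl *(1)] by blast
  qed
  then obtain s where s: "\<And>n. extends_below x (V n) T (s n)"
    "\<And>n. extends_below x (V (Suc n)) (snd (snd (s n))) (s (Suc n))"
    by metis
  define t where "t n = fst (s n)" for n
  define F where "F n = fst (snd (s n))" for n
  define R where "R n = snd (snd (s n))" for n
  have s_eq: "s n = (t n, F n, R n)" for n
    unfolding t_def F_def R_def by simp
  have 1: "t n \<in> T" "compactin M (F n)" "F n \<subseteq> V n" "\<And>u. u \<in> R n \<Longrightarrow> (t n, u) \<in> K_near (F n)" for n
    using s(1)[of n] unfolding extends_below_def s_eq by auto
  have 2: "t (Suc n) \<in> R n" "R (Suc n) \<subseteq> R n" for n
    using s(2)[of n] unfolding extends_below_def s_eq by auto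
  have "(t j, t k) \<in> K_near (F j)" if "j < k" for j k
  proof -
    obtain i where i: "k = Suc i" "j \<le> i"
      using \<open>j < k\<close> by (cases k) auto
    have "R i \<subseteq> R j"
      using lift_Suc_antimono_le[of R, OF 2(2) i(2)] .
    then show ?thesis
      using 1(4) 2(1)[of i] i(1) by blast
  qed
  moreover have "t n \<in> topspace X" for n
    using 1(1)[of n] T(1) unfolding accumulates_at_def countably_closed_in_def by blast
  ultimately show False
    using no_infinite_clique[OF F0 V(1,2,4), of t F] 1(2,3) by blast
qed

section \<open>Separation from the diagonal and metrizability\<close>

lemma countably_closed_in_imp_closedin:
  assumes "countably_closed_in X T"
  shows "closedin X T"
proof -
  have "X closure_of T \<subseteq> T"
    using not_accumulates_at assms unfolding accumulates_at_def by blast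
  then show ?thesis
    using assms closure_of_subset_eq[of T X] unfolding countably_closed_in_def by simp
qed

text \<open>Otherwise the cluster points \<open>S\<close> of the \<open>K_below (V n)\<close> form a
  set that is countably closed, hence closed in the square, and misses the diagonal. Normality
  separates the two by \<open>U\<close> and \<open>U'\<close>; but every
  \<open>K_below (V n)\<close> has points in \<open>U\<close>, so \<open>S\<close> has a point
  outside \<open>U'\<close>.\<close>

lemma ex_neighbourhood_off_diagonal:
  assumes F: "compactin M F"
  shows "\<exists>V. openin M V \<and> F \<subseteq> V \<and> (\<forall>x. (x, x) \<notin> prod_topology X X closure_of (K_below V))"
proof (rule ccontr)
  assume contra: "\<nexists>V. openin M V \<and> F \<subseteq> V \<and> (\<forall>x. (x, x) \<notin> prod_topology X X closure_of (K_below V))"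
  let ?P = "prod_topology X X" and ?D = "(\<lambda>x. (x, x)) ` topspace X"
  obtain V where V: "decseq V" "\<And>n. openin M (V n)" "\<And>n. F \<subseteq> V n"
    "\<And>W. openin M W \<Longrightarrow> F \<subseteq> W \<Longrightarrow> \<exists>n. V n \<subseteq> W"
    using compactin_decreasing_base[OF second_countable F] by metis
  define S where "S = cluster_points ?P (\<lambda>n. K_below (V n))"
  have "S \<subseteq> K_near F"
    unfolding S_def by (rule cluster_points_K_below[OF F V(1,4)])
  then have disj: "disjnt ?D S"
    using diagonal_notin_K_near[OF F] unfolding disjnt_def by blast
  have S: "closedin ?P S"
    unfolding S_def by (rule countably_closed_in_prod_imp_closedin[OF compact_space Hausdorff_space
          regular_space countably_closed_in_imp_closedin countably_closed_in_cluster_points])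
  have D: "closedin ?P ?D"
    using Hausdorff_space unfolding Hausdorff_space_closedin_diagonal .
  have "normal_space ?P"
    using compact_space Hausdorff_space
    by (intro compact_Hausdorff_or_regular_imp_normal_space disjI1)
      (simp_all add: compact_space_prod_topology Hausdorff_space_prod_topology)
  then have "\<exists>U U'. openin ?P U \<and> openin ?P U' \<and> ?D \<subseteq> U \<and> S \<subseteq> U' \<and> disjnt U U'"
    using D S disj unfolding normal_space_def by simp
  then obtain U U' where U: "openin ?P U" "openin ?P U'" "?D \<subseteq> U" "S \<subseteq> U'" "disjnt U U'"
    by (elim exE conjE)
  have "(topspace ?P - U') \<inter> K_below (V n) \<noteq> {}" for n
  proof -
    obtain x where x: "(x, x) \<in> ?P closure_of (K_below (V n))"
      using contra V(2,3) by blast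
    then have "(x, x) \<in> U"
      using U(3) by (auto simp: in_closure_of)
    then obtain y where "y \<in> K_below (V n)" "y \<in> U"
      using in_closure_ofD[OF x U(1)] by blast
    then show ?thesis
      using U(5) openin_subset[OF U(1)] unfolding disjnt_def by blast
  qed
  then have "S \<inter> (topspace ?P - U') \<noteq> {}"
    unfolding S_def using compact_space closedin_diff[OF closedin_topspace U(2)]
    by (intro cluster_points_meets_closed) (simp_all add: compact_space_prod_topology)
  then show False
    using U(4) by blast
qed

lemma metrizable_space: "metrizable_space X"
proof -
  obtain \<U> where \<U>: "countable \<U>" "\<And>U. U \<in> \<U> \<Longrightarrow> openin M U"
    "\<And>F V. compactin M F \<Longrightarrow> openin M V \<Longrightarrow> F \<subseteq> V \<Longrightarrow> \<exists>U\<in>\<U>. F \<subseteq> U \<and> U \<subseteq> V"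
    using second_countable_compact_base[OF second_countable] by metis
  let ?cl = "\<lambda>U. prod_topology X X closure_of (K_below U)"
  \<comment> \<open>Basic sets that are too large, with closure reaching the diagonal, contribute
    the empty set.\<close>
  define C where
    "C n = (if \<exists>x. (x, x) \<in> ?cl (from_nat_into \<U> n) then {} else ?cl (from_nat_into \<U> n))" for n
  show ?thesis
  proof (rule metrizable_space_if_sigma_compact_off_diagonal[OF compact_space])
    show "completely_regular_space X"
      using compact_space Hausdorff_space
      by (intro normal_imp_completely_regular_space compact_Hausdorff_or_regular_imp_normal_space) auto
    show "t1_space X"
      using Hausdorff_space by (rule Hausdorff_imp_t1_space)
    show "closedin (prod_topology X X) (C n)" for n
      unfolding C_def by simp
    show "(x, x) \<notin> C n" for n x
      unfolding C_def by simp
    fix x y assume "x \<in> topspace X" "y \<in> topspace X" "x \<noteq> y"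
    then obtain F where F: "compactin M F" "(x, y) \<in> K F"
      using K_cover by blast
    obtain V where V: "openin M V" "F \<subseteq> V" "\<And>x. (x, x) \<notin> ?cl V"
      using ex_neighbourhood_off_diagonal[OF F(1)] by blast
    obtain U where U: "U \<in> \<U>" "F \<subseteq> U" "U \<subseteq> V"
      using \<U>(3)[OF F(1) V(1,2)] by blast
    then obtain n where n: "U = from_nat_into \<U> n"
      using range_from_nat_into[of \<U>] \<U>(1) by (metis emptyE imageE)
    have "(x, x) \<notin> ?cl U" for x
      using V(3) closure_of_mono[OF K_below_mono[OF U(3)]] by blast
    moreover have "(x, y) \<in> ?cl U"
      using closure_of_subset[OF K_below_subset] K_belowI[OF F(1) U(2) F(2)] by blast
    ultimately show "\<exists>n. (x, y) \<in> C n"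
      unfolding C_def n by (intro exI[of _ n]) simp
  qed
qed

end

theorem theorem5p5:
  fixes X :: "'a topology" and M :: "'m set" and d :: "'m \<Rightarrow> 'm \<Rightarrow> real"
  assumes "\<bb> <o \<dd>" and "\<bb> =o \<aleph>\<^sub>1"
    and "compact_space X" and "completely_regular_space X" and "t1_space X"
    and "Metric_space M d" and "separable_space (Metric_space.mtopology M d)"
    and "has_diagonal (Metric_space.mtopology M d) X"
  shows "metrizable_space X"
proof -
  let ?M = "Metric_space.mtopology M d" and ?P = "prod_topology X X"
  have Haus: "Hausdorff_space X"
    using assms(4,5) completely_regular_imp_regular_space regular_t1_imp_Hausdorff_space by blast
  obtain K where
    K: "\<forall>F. compactin ?M F \<longrightarrow> compactin (subtopology ?P
      (topspace X \<times> topspace X - {(x, x) |x. x \<in> topspace X})) (K F)"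
    and cover: "(\<Union>F\<in>{F. compactin ?M F}. K F) = topspace (subtopology ?P
      (topspace X \<times> topspace X - {(x, x) |x. x \<in> topspace X}))"
    and mono: "\<forall>F F'. compactin ?M F \<longrightarrow> compactin ?M F' \<longrightarrow> F \<subseteq> F' \<longrightarrow> K F \<subseteq> K F'"
    using assms(8) unfolding has_diagonal_def dominated_by_def by (elim exE conjE)
  \<comment> \<open>Compactness in the subspace becomes compactness in the square, hence closedness
    there, the square being Hausdorff.\<close>
  have K': "compactin ?P (K F)" "K F \<subseteq> topspace X \<times> topspace X - {(x, x) |x. x \<in> topspace X}"
    if "compactin ?M F" for F
    using K that by (simp_all add: compactin_subtopology)
  have "off_diagonal_cover X ?M K"
  proof
    show "second_countable ?M"
      using Metric_space.separable_imp_second_countable[OF assms(6,7)] .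
    show "closedin ?P (K F)" if "compactin ?M F" for F
      using compactin_imp_closedin[OF _ K'(1)[OF that]] Haus
      by (simp add: Hausdorff_space_prod_topology)
    show "(x, x) \<notin> K F" if "compactin ?M F" for F x
      using K'(2)[OF that] by auto
    show "K F \<subseteq> K G" if "compactin ?M F" "compactin ?M G" "F \<subseteq> G" for F G
      using mono that by simp
    show "\<exists>F. compactin ?M F \<and> (x, y) \<in> K F"
      if "x \<in> topspace X" "y \<in> topspace X" "x \<noteq> y" for x y
    proof -
      have "(x, y) \<in> (\<Union>F\<in>{F. compactin ?M F}. K F)"
        unfolding cover using that by simp
      then show ?thesis
        by simp
    qed
  qed (use assms(3) Haus in simp_all)
  then show ?thesis
    by (rule off_diagonal_cover.metrizable_space)
qed

end
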